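(* For all $n\geq1$, \[ P_{n}^{(\mathrm{lpk},\mathrm{ilpk})}(s,t) =\frac{1}{n!}\sum_{k=0}^n e(n,k)\left((1-s)(1-t)\right)^{\frac{n-k}{2}}P_{k}^{\mathrm{lpk}}(s)P_{k}^{\mathrm{lpk}}(t), \] where $P_{n}^{(\mathrm{lpk},\mathrm{ilpk})}(s,t)=\sum_{\pi\in\mathfrak{S}_{n}}s^{\mathrm{lpk}(\pi)}t^{\mathrm{ilpk}(\pi)}$.
   Context: $\mathfrak{S}_n$ is the symmetric group on $[n]$. For $\pi\in\mathfrak{S}_n$, $i$ with $2\le i\le n-1$ is a peak if $\pi(i-1)<\pi(i)>\pi(i+1)$; $i\in[n-1]$ is a left peak if $i$ is a peak, or if $i=1$ and $\pi(1)>\pi(2)$; $\mathrm{lpk}(\pi)$ is the number of left peaks and $\mathrm{ilpk}(\pi)=\mathrm{lpk}(\pi^{-1})$. The left peak polynomials are $P_n^{\mathrm{lpk}}(t)=\sum_{\pi\in\mathfrak{S}_n}t^{\mathrm{lpk}(\pi)}$, with $P_0^{\mathrm{lpk}}(t)=1$. $e(n,k)$ is the number of permutations in $\mathfrak{S}_n$ with exactly $k$ cycles of odd length (and any number of even cycles); $e(n,k)=0$ when $n-k$ is odd. *)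

theory Defs
  imports Complex_Main "HOL-Combinatorics.Permutations" "HOL-Combinatorics.Orbits"
begin

definition is_peak :: "nat \<Rightarrow> (nat \<Rightarrow> nat) \<Rightarrow> nat \<Rightarrow> bool" where
  "is_peak n p i \<longleftrightarrow> i \<in> {2..n - 1} \<and> p (i - 1) < p i \<and> p i > p (i + 1)"

definition is_left_peak :: "nat \<Rightarrow> (nat \<Rightarrow> nat) \<Rightarrow> nat \<Rightarrow> bool" where
  "is_left_peak n p i \<longleftrightarrow> i \<in> {1..n - 1} \<and> (is_peak n p i \<or> (i = 1 \<and> p 1 > p 2))"

definition lpk :: "nat \<Rightarrow> (nat \<Rightarrow> nat) \<Rightarrow> nat" where
  "lpk n p = card {i. is_left_peak n p i}"

definition ilpk :: "nat \<Rightarrow> (nat \<Rightarrow> nat) \<Rightarrow> nat" where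
  "ilpk n p = lpk n (inv p)"

text \<open>
  The polynomials are evaluated at elements of an arbitrary field of characteristic zero. Since
  the field may be a field of rational functions, identities that hold for all such arguments
  include the identities of formal polynomials.
\<close>

definition P_lpk :: "nat \<Rightarrow> 'a::field_char_0 \<Rightarrow> 'a" where
  "P_lpk n t = (\<Sum>p | p permutes {1..n}. t ^ lpk n p)"

definition P_lpk_ilpk :: "nat \<Rightarrow> 'a::field_char_0 \<Rightarrow> 'a \<Rightarrow> 'a" where
  "P_lpk_ilpk n s t = (\<Sum>p | p permutes {1..n}. s ^ lpk n p * t ^ ilpk n p)"

text \<open>The cycles of a permutation are identified with its orbits, fixed points included.\<close>

definition odd_cycles :: "nat \<Rightarrow> (nat \<Rightarrow> nat) \<Rightarrow> nat set set" where
  "odd_cycles n p = {C \<in> orbit p ` {1..n}. odd (card C)}"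

definition e :: "nat \<Rightarrow> nat \<Rightarrow> nat" where
  "e n k = card {p. p permutes {1..n} \<and> card (odd_cycles n p) = k}"

lemma P_lpk_0: "P_lpk 0 t = 1"
  by (simp add: P_lpk_def lpk_def is_left_peak_def)

lemma e_eq_0_if_odd:
  assumes "k \<le> n" "odd (n - k)"
  shows "e n k = 0"
proof -
  have "even (n + card (odd_cycles n p))" if p: "p permutes {1..n}" for p
  proof -
    have perm: "permutation p"
      using p by (auto simp: permutation_permutes)
    let ?O = "orbit p ` {1..n}"
    have U: "\<Union>?O = {1..n}"
      using permutes_orbit_subset[OF p] permutation_self_in_orbit[OF perm] by blast
    have fin: "finite C" if "C \<in> ?O" for C
      using that U finite_subset[of C "{1..n}"] by blast
    have disj: "C \<inter> D = {}" if "C \<in> ?O" "D \<in> ?O" "C \<noteq> D" for C D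
    proof (rule ccontr)
      assume "C \<inter> D \<noteq> {}"
      then obtain x where "x \<in> C" "x \<in> D" by blast
      then have "C = orbit p x" "D = orbit p x"
        using that cyclic_on_orbit'[OF perm] orbit_cyclic_eq3 by (metis imageE)+
      then show False using that(3) by simp
    qed
    have "n = card (\<Union>?O)" by (subst U) simp
    also have "\<dots> = (\<Sum>C\<in>?O. card C)"
      by (rule card_Union_disjoint) (use fin disj in \<open>auto simp: pairwise_def disjnt_def\<close>)
    finally have "even n \<longleftrightarrow> even (\<Sum>C\<in>?O. card C)" by simp
    also have "\<dots> \<longleftrightarrow> even (card {C \<in> ?O. odd (card C)})"
      by (rule even_sum_iff) simp
    finally show ?thesis by (simp add: odd_cycles_def)
  qed
  then have "{p. p permutes {1..n} \<and> card (odd_cycles n p) = k} = {}"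
    using assms by (force simp: even_diff_nat)
  then show ?thesis unfolding e_def by (metis card.empty)
qed

end

theory Submission
  imports Defs "HOL-Computational_Algebra.Polynomial_FPS" "HOL-Library.FuncSet"
begin

text \<open>
  For a permutation \<open>\<sigma>\<close> count the weakly increasing maps \<open>g\<close> from \<open>{1..n}\<close> to \<open>{..<2 * a + 1}\<close>
  that take an even value twice in a row only at an ascent of \<open>\<sigma>\<close> and an odd value twice in a row
  only at a descent (Petersen's left enriched \<open>P\<close>-partitions, with \<open>0 < -1 < 1 < -2 < 2 < \<dots>\<close>
  renamed to \<open>0 < 1 < 2 < \<dots>\<close>). The generating function of these numbers in \<open>a\<close> is
  \<open>(1 + x)^n / (1 - x)^(n + 1) * (4 * x / (1 + x)^2)^lpk(\<sigma>)\<close>.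

  Sorting a word yields a bijection between words of length \<open>n\<close> and pairs \<open>(\<sigma>, g)\<close>, so the numbers
  add up to \<open>(2 * a + 1)^n\<close>. If pairs of letters are enumerated row by row, with every other row
  reversed, the same bijection shows that the products of the numbers for \<open>(\<sigma>, a)\<close> and
  \<open>(inv \<sigma>, b)\<close> add up to the number for \<open>(id, m)\<close> where \<open>2 * m + 1 = (2 * a + 1) * (2 * b + 1)\<close>.
  As a function of \<open>n\<close>, the latter satisfies the same recurrence as
  \<open>(\<Sum>k. e n k * (2 * m + 1)^k) / n!\<close>. Hence both sides of the theorem agree after substituting
  \<open>4 * x / (1 + x)^2\<close> for each variable, and this substitution is injective.
\<close>

unbundle fps_syntax

section \<open>Permutations by number of odd cycles\<close>

lemma transpose_comp_step:
  assumes "q permutes S" "a \<notin> S" "b \<in> S"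
  shows "(transpose a b \<circ> q) a = b"
    and "x \<in> S \<Longrightarrow> (transpose a b \<circ> q) x = (if q x = b then a else q x)"
  using assms permutes_in_image[OF assms(1), of x] permutes_not_in[OF assms(1,2)]
  by (auto simp: transpose_def)

text \<open>Since \<open>p a = b\<close> and the \<open>q\<close>-preimage of \<open>b\<close> is
  sent to \<open>a\<close>, the point \<open>a\<close> is spliced into the cycle of \<open>b\<close>
  immediately before \<open>b\<close>. A cycle avoiding \<open>b\<close> never meets the changed
  arrows.\<close>

lemma orbit_transpose_comp:
  assumes S: "finite S" and q: "q permutes S" and a: "a \<notin> S" and b: "b \<in> S"
  defines "p \<equiv> transpose a b \<circ> q"
  shows "x \<in> S \<Longrightarrow> x \<notin> orbit q b \<Longrightarrow> orbit p x = orbit q x"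
    and "x \<in> insert a (orbit q b) \<Longrightarrow> orbit p x = insert a (orbit q b)"
proof -
  note pstep = transpose_comp_step[OF q a b, folded p_def]
  have perm_q: "permutation q" using q S by (auto simp: permutation_permutes)
  have "p permutes insert a S"
    unfolding p_def using b q by (auto intro!: permutes_compose permutes_swap_id intro: permutes_subset)
  then have perm_p: "permutation p" using S by (auto simp: permutation_permutes)
  have qS: "orbit q x \<subseteq> S" if "x \<in> S" for x
    using permutes_orbit_subset[OF q that] .
  \<comment> \<open>Iterating \<open>p\<close> follows the walk of \<open>q\<close>, except for a
    detour through \<open>a\<close> on each arrival at \<open>b\<close>.\<close>
  have sub: "orbit q x \<subseteq> orbit p x" if x: "x \<in> S" for x
  proof
    fix y assume "y \<in> orbit q x"
    then show "y \<in> orbit p x"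
    proof induction
      case base
      show ?case
      proof (cases "q x = b")
        case True
        then have "p x = a" "p a = b" using pstep x by auto
        then show ?thesis using True by (metis orbit.intros)
      next
        case False
        then show ?thesis using pstep x by (metis orbit.base)
      qed
    next
      case (step y)
      then have y: "y \<in> S" using qS x by auto
      show ?case
      proof (cases "q y = b")
        case True
        then have "p y = a" "p a = b" using pstep y by auto
        then show ?thesis using True step.IH by (metis orbit.step)
      next
        case False
        then have "p y = q y" using pstep y by auto
        then show ?thesis using step.IH by (metis orbit.step)
      qed
    qed
  qed
  have same: "orbit q x = orbit q y" if "y \<in> orbit q x" for x y
    using that cyclic_on_orbit'[OF perm_q] orbit_cyclic_eq3 by metis
  have psame: "orbit p x = orbit p y" if "y \<in> orbit p x" for x y
    using that cyclic_on_orbit'[OF perm_p] orbit_cyclic_eq3 by metis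
  show "orbit p x = orbit q x" if x: "x \<in> S" "x \<notin> orbit q b"
  proof
    have "b \<notin> orbit q x"
      using same permutation_self_in_orbit[OF perm_q] x(2) by blast
    then have pq: "p y = q y" if "y = x \<or> y \<in> orbit q x" for y
    proof -
      have "q y \<in> orbit q x" using that by (auto intro: orbit.intros)
      then have "q y \<noteq> b" using \<open>b \<notin> orbit q x\<close> by auto
      moreover have "y \<in> S" using that x qS by auto
      ultimately show ?thesis using pstep(2) by simp
    qed
    have "y \<in> orbit q x" if "y \<in> orbit p x" for y
      using that
    proof induction
      case base
      show ?case using pq[of x] orbit.base[of q x] by simp
    next
      case (step y)
      then show ?case using pq[of y] orbit.step[of y q x] by simp
    qed
    then show "orbit p x \<subseteq> orbit q x" by auto
  qed (rule sub[OF x(1)])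
  have bb: "b \<in> orbit q b" using permutation_self_in_orbit[OF perm_q] .
  have stepC: "p y \<in> insert a (orbit q b)" if "y \<in> insert a (orbit q b)" for y
  proof (cases "y = a")
    case False
    then have "y \<in> S" "y \<in> orbit q b" using that qS b by auto
    then show ?thesis using pstep(2) by (auto intro: orbit.step)
  qed (use pstep bb in auto)
  have "y \<in> insert a (orbit q b)" if "y \<in> orbit p b" for y
    using that by induction (use stepC bb in auto)
  moreover have "a \<in> orbit p b"
  proof -
    have "b \<in> orbit p a" using pstep(1) by (metis orbit.base)
    then show ?thesis using psame permutation_self_in_orbit[OF perm_p] by blast
  qed
  ultimately have C: "orbit p b = insert a (orbit q b)" using sub[OF b] by auto
  show "orbit p x = insert a (orbit q b)" if "x \<in> insert a (orbit q b)"
    using psame[of x b] that C by simp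
qed

lemma orbits_transpose_comp:
  assumes S: "finite S" and q: "q permutes S" and a: "a \<notin> S" and b: "b \<in> S"
  shows "orbit (transpose a b \<circ> q) ` insert a S
    = insert (insert a (orbit q b)) (orbit q ` S - {orbit q b})"
proof -
  have perm_q: "permutation q" using q S by (auto simp: permutation_permutes)
  have same: "orbit q x = orbit q y" if "y \<in> orbit q x" for x y
    using that cyclic_on_orbit'[OF perm_q] orbit_cyclic_eq3 by metis
  have self: "x \<in> orbit q x" for x using permutation_self_in_orbit[OF perm_q] .
  have "orbit q b \<subseteq> S" using permutes_orbit_subset[OF q b] .
  then have "insert a S = insert a (orbit q b) \<union> (S - orbit q b)" by auto
  then have "orbit (transpose a b \<circ> q) ` insert a S
    = orbit (transpose a b \<circ> q) ` insert a (orbit q b)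
      \<union> orbit (transpose a b \<circ> q) ` (S - orbit q b)"
    by (metis image_Un)
  also have "orbit (transpose a b \<circ> q) ` insert a (orbit q b) = {insert a (orbit q b)}"
    using orbit_transpose_comp(2)[OF assms] by (auto simp: image_iff)
  also have "orbit (transpose a b \<circ> q) ` (S - orbit q b) = orbit q ` (S - orbit q b)"
    using orbit_transpose_comp(1)[OF assms] by (intro image_cong) auto
  also have "\<dots> = orbit q ` S - {orbit q b}"
    using same self by (auto simp: image_iff)
  finally show ?thesis by (simp only: insert_is_Un[symmetric])
qed

section \<open>Number of odd cycles when points are inserted\<close>

definition num_odd :: "'a set set \<Rightarrow> nat" where
  "num_odd A = card {C \<in> A. odd (card C)}"

lemma num_odd_insert:
  assumes "finite A" "C \<notin> A"
  shows "num_odd (insert C A) = num_odd A + (if odd (card C) then 1 else 0)"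
proof -
  have "{D \<in> insert C A. odd (card D)}
    = (if odd (card C) then insert C {D \<in> A. odd (card D)} else {D \<in> A. odd (card D)})"
    by auto
  then show ?thesis using assms by (simp add: num_odd_def)
qed

text \<open>Only the cycle of \<open>b\<close> changes, and its length grows by one, so its parity
  flips. Terms are added on both sides to avoid subtraction of natural numbers.\<close>

lemma num_odd_orbits_transpose_comp:
  assumes S: "finite S" and q: "q permutes S" and a: "a \<notin> S" and b: "b \<in> S"
  shows "num_odd (orbit (transpose a b \<circ> q) ` insert a S) + (if odd (card (orbit q b)) then 1 else 0)
    = num_odd (orbit q ` S) + (if odd (card (orbit q b)) then 0 else 1)"
proof -
  let ?A = "orbit q ` S - {orbit q b}"
  have sub: "orbit q x \<subseteq> S" if "x \<in> S" for x using permutes_orbit_subset[OF q that] .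
  have "a \<notin> orbit q b" "finite (orbit q b)" using sub[OF b] a S finite_subset by auto
  then have c: "card (insert a (orbit q b)) = Suc (card (orbit q b))" by simp
  have "insert a (orbit q b) \<notin> ?A" using sub a by blast
  then have "num_odd (insert (insert a (orbit q b)) ?A)
    = num_odd ?A + (if odd (card (orbit q b)) then 0 else 1)"
    using S c by (subst num_odd_insert) auto
  moreover have "num_odd (orbit q ` S) = num_odd ?A + (if odd (card (orbit q b)) then 1 else 0)"
    using S b num_odd_insert[of ?A "orbit q b"] by (simp add: insert_absorb)
  ultimately show ?thesis using orbits_transpose_comp[OF assms] by simp
qed

lemma orbits_insert_fixpoint:
  assumes "q permutes S" "a \<notin> S"
  shows "orbit q ` insert a S = insert {a} (orbit q ` S)"
proof -
  have "orbit q a = {a}" using permutes_not_in[OF assms] by (simp add: orbit_eq_singleton_iff)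
  then show ?thesis by simp
qed

lemma num_odd_orbits_insert_fixpoint:
  assumes "finite S" "q permutes S" "a \<notin> S"
  shows "num_odd (orbit q ` insert a S) = Suc (num_odd (orbit q ` S))"
proof -
  have "{a} \<notin> orbit q ` S" using permutes_orbit_subset[OF assms(2)] assms(3) by blast
  then show ?thesis using assms by (simp add: orbits_insert_fixpoint num_odd_insert del: image_insert)
qed

text \<open>If \<open>c = b\<close>, the two new points form a cycle of length two. Otherwise both
  join the cycle of \<open>c\<close>, whose parity flips twice.\<close>

lemma num_odd_orbits_insert_two:
  assumes S: "finite S" and r: "r permutes S" and "a \<notin> S" "b \<notin> S" "a \<noteq> b" and c: "c \<in> insert b S"
  shows "num_odd (orbit (transpose a b \<circ> (transpose b c \<circ> r)) ` insert a (insert b S))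
    = num_odd (orbit r ` S)"
proof -
  have q: "transpose b c \<circ> r permutes insert b S"
    using r c by (auto intro!: permutes_compose permutes_swap_id intro: permutes_subset)
  note 1 = num_odd_orbits_transpose_comp[OF _ q, of a b]
  show ?thesis
  proof (cases "c = b")
    case True
    then have "orbit (transpose b c \<circ> r) b = {b}"
      using permutes_not_in[OF r] assms by (simp add: orbit_eq_singleton_iff)
    then show ?thesis using 1 assms True num_odd_orbits_insert_fixpoint[OF S r, of b] by simp
  next
    case False
    then have c: "c \<in> S" using c by simp
    have "orbit (transpose b c \<circ> r) b = insert b (orbit r c)"
      using orbit_transpose_comp(2)[OF S r _ c, of b b] assms by simp
    moreover have "b \<notin> orbit r c" "finite (orbit r c)"
      using permutes_orbit_subset[OF r c] S assms finite_subset by auto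
    ultimately have "card (orbit (transpose b c \<circ> r) b) = Suc (card (orbit r c))" by simp
    then show ?thesis using 1 num_odd_orbits_transpose_comp[OF S r _ c, of b] assms
      by (simp split: if_splits)
  qed
qed

definition odd_cycle_poly :: "'b set \<Rightarrow> 'a::comm_semiring_1 \<Rightarrow> 'a" where
  "odd_cycle_poly S y = (\<Sum>p | p permutes S. y ^ num_odd (orbit p ` S))"

text \<open>
  If \<open>a\<close> is not fixed, deleting \<open>a\<close> and its image \<open>b\<close> from their cycle preserves all parities;
  the two points can be put back in \<open>card S\<close> ways.
\<close>

lemma odd_cycle_poly_insert:
  assumes S: "finite S" and a: "a \<notin> S"
  shows "odd_cycle_poly (insert a S) y
    = y * odd_cycle_poly S y + of_nat (card S) * (\<Sum>b\<in>S. odd_cycle_poly (S - {b}) y)"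
proof -
  have "odd_cycle_poly (insert a S) y = (\<Sum>b\<in>insert a S. \<Sum>q | q permutes S.
      y ^ num_odd (orbit (transpose a b \<circ> q) ` insert a S))"
    unfolding odd_cycle_poly_def by (rule sum_over_permutations_insert[OF assms])
  also have "\<dots> = (\<Sum>q | q permutes S. y ^ num_odd (orbit q ` insert a S))
    + (\<Sum>b\<in>S. \<Sum>q | q permutes S. y ^ num_odd (orbit (transpose a b \<circ> q) ` insert a S))"
    using assms by simp
  also have "(\<Sum>q | q permutes S. y ^ num_odd (orbit q ` insert a S)) = y * odd_cycle_poly S y"
    unfolding odd_cycle_poly_def sum_distrib_left
    by (intro sum.cong refl) (use assms in \<open>simp add: num_odd_orbits_insert_fixpoint del: image_insert\<close>)
  also have "(\<Sum>b\<in>S. \<Sum>q | q permutes S. y ^ num_odd (orbit (transpose a b \<circ> q) ` insert a S))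
    = (\<Sum>b\<in>S. of_nat (card S) * odd_cycle_poly (S - {b}) y)"
  proof (intro sum.cong refl)
    fix b assume b: "b \<in> S"
    define R where "R = S - {b}"
    have R: "S = insert b R" "b \<notin> R" "finite R" "a \<notin> R" "a \<noteq> b" using b S a by (auto simp: R_def)
    have "(\<Sum>q | q permutes S. y ^ num_odd (orbit (transpose a b \<circ> q) ` insert a S))
      = (\<Sum>c\<in>insert b R. \<Sum>r | r permutes R.
          y ^ num_odd (orbit (transpose a b \<circ> (transpose b c \<circ> r)) ` insert a (insert b R)))"
      unfolding R(1) by (rule sum_over_permutations_insert[OF R(3,2)])
    also have "\<dots> = (\<Sum>c\<in>insert b R. \<Sum>r | r permutes R. y ^ num_odd (orbit r ` R))"
      by (intro sum.cong refl)
        (use R in \<open>simp add: num_odd_orbits_insert_two del: image_insert\<close>)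
    finally show "(\<Sum>q | q permutes S. y ^ num_odd (orbit (transpose a b \<circ> q) ` insert a S))
        = of_nat (card S) * odd_cycle_poly (S - {b}) y"
      unfolding R_def[symmetric] by (simp add: odd_cycle_poly_def R(1))
  qed
  finally show ?thesis by (simp add: sum_distrib_left)
qed

section \<open>The generating function of the identity permutation\<close>

text \<open>The coefficients are the Delannoy numbers. They turn out to be the counts of enriched
  maps for the identity, where no peak factor occurs.\<close>

definition base_gf :: "nat \<Rightarrow> 'a::field fps" where
  "base_gf n = (1 + fps_X) ^ n * inverse (1 - fps_X) ^ Suc n"

definition peak_gf :: "'a::field fps" where
  "peak_gf = 4 * fps_X * inverse (1 + fps_X) ^ 2"

lemma one_minus_fps_X_inverse: "(1 - fps_X) * inverse (1 - fps_X) = (1 :: 'a::field fps)"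
  by (rule inverse_mult_eq_1') simp

lemma one_plus_fps_X_inverse: "(1 + fps_X) * inverse (1 + fps_X) = (1 :: 'a::field fps)"
  by (rule inverse_mult_eq_1') simp

lemma eq_inverse_one_minus_fps_X:
  assumes "(1 - fps_X) * F = (G :: 'a::field fps)"
  shows "F = inverse (1 - fps_X) * G"
  using assms one_minus_fps_X_inverse by (metis mult.assoc mult.commute mult_1)

lemma fps_two_mult_nth: "(2 * F) $ m = 2 * (F $ m :: 'a::field)"
  by (simp only: mult_2 fps_add_nth)

lemma base_gf_0: "base_gf 0 = (Abs_fps (\<lambda>_. 1) :: 'a::field fps)"
  by (simp add: base_gf_def fps_inverse_gp' [symmetric] fps_inverse_idempotent)

lemma base_gf_Suc: "base_gf (Suc n) = (1 + fps_X) * inverse (1 - fps_X) * base_gf n"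
  by (simp add: base_gf_def)

lemma base_gf_Suc': "(1 - fps_X) * base_gf (Suc n) = (1 + fps_X) * (base_gf n :: 'a::field fps)"
proof -
  have "(1 - fps_X) * base_gf (Suc n)
    = ((1 - fps_X) * inverse (1 - fps_X)) * ((1 + fps_X) * (base_gf n :: 'a fps))"
    by (simp only: base_gf_Suc ac_simps)
  then show ?thesis by (simp add: one_minus_fps_X_inverse)
qed

text \<open>This is the logarithmic derivative \<open>n / (1 + x) + (n + 1) / (1 - x)\<close> with
  denominators cleared.\<close>

lemma fps_deriv_base_gf:
  "(1 - fps_X) * (1 + fps_X) * fps_deriv (base_gf n)
    = (of_nat (2 * n + 1) + fps_X) * (base_gf n :: 'a::field fps)"
proof (induction n)
  case 0
  let ?u = "inverse (1 - fps_X) :: 'a fps"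
  have "fps_deriv ((1 - fps_X) * ?u) = 0" by (simp add: one_minus_fps_X_inverse)
  then have "(1 - fps_X) * fps_deriv ?u = ?u" by (simp add: algebra_simps)
  then have "(1 - fps_X) * (1 + fps_X) * fps_deriv ?u = (1 + fps_X) * ?u"
    by (metis mult.assoc mult.commute)
  then show ?case by (simp add: base_gf_def)
next
  case (Suc n)
  let ?W = "base_gf n :: 'a fps" and ?V = "base_gf (Suc n) :: 'a fps"
  let ?W' = "fps_deriv ?W" and ?V' = "fps_deriv ?V"
  have VW: "(1 - fps_X) * ?V = (1 + fps_X) * ?W" by (rule base_gf_Suc')
  then have "fps_deriv ((1 - fps_X) * ?V) = fps_deriv ((1 + fps_X) * ?W)" by simp
  then have V': "(1 - fps_X) * ?V' = ?V + ?W + (1 + fps_X) * ?W'"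
    by (simp add: algebra_simps)
  \<comment> \<open>One more factor \<open>1 - fps_X\<close> allows \<open>V'\<close> and
    \<open>VW\<close> to be substituted; it is cancelled at the end.\<close>
  have "(1 - fps_X) * ((1 - fps_X) * (1 + fps_X) * ?V')
    = (1 + fps_X) * ((1 - fps_X) * ((1 - fps_X) * ?V'))" by (simp only: ac_simps)
  also have "\<dots> = (1 + fps_X) * ((1 - fps_X) * ?V + (1 - fps_X) * ?W + (1 - fps_X) * (1 + fps_X) * ?W')"
    unfolding V' by (simp only: distrib_left ac_simps)
  also have "\<dots> = (1 + fps_X) * ((1 + fps_X) * ?W + (1 - fps_X) * ?W + (of_nat (2 * n + 1) + fps_X) * ?W)"
    unfolding VW Suc.IH ..
  also have "\<dots> = (of_nat (2 * Suc n + 1) + fps_X) * ((1 + fps_X) * ?W)"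
    by (simp add: algebra_simps)
  also have "\<dots> = (1 - fps_X) * ((of_nat (2 * Suc n + 1) + fps_X) * ?V)"
    unfolding VW[symmetric] by (simp only: ac_simps)
  finally have eq: "(1 - fps_X) * ((1 - fps_X) * (1 + fps_X) * ?V')
      = (1 - fps_X) * ((of_nat (2 * Suc n + 1) + fps_X) * ?V)" .
  have "(1 - fps_X :: 'a fps) \<noteq> 0" by (metis mult_zero_left one_minus_fps_X_inverse zero_neq_one)
  with eq show ?case by (metis mult_left_cancel)
qed

text \<open>Multiplied by \<open>(1 - fps_X) * (1 + fps_X)\<close>, every term becomes a polynomial
  multiple of \<open>base_gf n\<close>. The operator \<open>2 * x * d/dx + 1\<close> is chosen
  because it multiplies the coefficient at \<open>m\<close> by \<open>2 * m + 1\<close>. For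
  \<open>n = 0\<close> the truncated index \<open>n - 1\<close> is harmless, as its factor is
  zero.\<close>

lemma base_gf_rec:
  "of_nat (Suc n) * base_gf (Suc n)
    = 2 * (fps_X * fps_deriv (base_gf n)) + base_gf n + of_nat n * (base_gf (n - 1) :: 'a::field fps)"
proof -
  let ?A = "1 - fps_X :: 'a fps" and ?B = "1 + fps_X :: 'a fps"
  let ?W = "base_gf n :: 'a fps" and ?V = "base_gf (n - 1) :: 'a fps"
  have V: "of_nat n * (?A * ?W) = of_nat n * (?B * ?V)"
    using base_gf_Suc'[of "n - 1", where 'a = 'a] by (cases n) auto
  have D: "?A * ?B * fps_deriv ?W = (of_nat (2 * n + 1) + fps_X) * ?W"
    by (rule fps_deriv_base_gf)
  have "?A * ?B * (2 * (fps_X * fps_deriv ?W) + ?W + of_nat n * ?V)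
    = 2 * fps_X * (?A * ?B * fps_deriv ?W) + ?A * ?B * ?W + ?A * (of_nat n * (?B * ?V))"
    by (simp add: algebra_simps)
  also have "\<dots> = 2 * fps_X * ((of_nat (2 * n + 1) + fps_X) * ?W) + ?A * ?B * ?W + ?A * (of_nat n * (?A * ?W))"
    unfolding D V ..
  also have "\<dots> = of_nat (Suc n) * ?B * (?B * ?W)"
    by (simp add: algebra_simps)
  also have "\<dots> = of_nat (Suc n) * ?B * (?A * base_gf (Suc n))"
    unfolding base_gf_Suc' ..
  also have "\<dots> = ?A * ?B * (of_nat (Suc n) * base_gf (Suc n))"
    by (simp only: ac_simps)
  finally have eq: "?A * ?B * (2 * (fps_X * fps_deriv ?W) + ?W + of_nat n * ?V) =
    ?A * ?B * (of_nat (Suc n) * base_gf (Suc n))" .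
  have "?A \<noteq> 0" "?B \<noteq> 0"
    by (metis mult_zero_left one_minus_fps_X_inverse zero_neq_one)
      (metis mult_zero_left one_plus_fps_X_inverse zero_neq_one)
  then have "?A * ?B \<noteq> 0" by simp
  with eq show ?thesis by (metis mult_left_cancel)
qed

lemma base_gf_nth_rec:
  "of_nat (Suc n) * base_gf (Suc n) $ m
    = of_nat (2 * m + 1) * base_gf n $ m + of_nat n * (base_gf (n - 1) $ m :: 'a::field)"
proof -
  have "(of_nat (Suc n) * base_gf (Suc n)) $ m
    = (2 * (fps_X * fps_deriv (base_gf n)) + base_gf n + of_nat n * (base_gf (n - 1) :: 'a fps)) $ m"
    by (simp only: base_gf_rec)
  moreover have "(fps_X * fps_deriv (base_gf n :: 'a fps)) $ m = of_nat m * base_gf n $ m"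
    by (cases m) simp_all
  moreover have "(of_nat k * F) $ m = of_nat k * F $ m" for k and F :: "'a fps"
    by (metis fps_mult_left_const_nth fps_of_nat)
  moreover have "(2 * F) $ m = 2 * F $ m" for F :: "'a fps"
    by (rule fps_two_mult_nth)
  ultimately have "of_nat (Suc n) * base_gf (Suc n) $ m
    = 2 * (of_nat m * base_gf n $ m) + base_gf n $ m + of_nat n * (base_gf (n - 1) $ m :: 'a)"
    by (simp only: fps_add_nth)
  then show ?thesis by (simp add: algebra_simps)
qed

text \<open>Divided by the factorial, the recurrence \<open>odd_cycle_poly_insert\<close> at
  \<open>y = 2 * m + 1\<close> is exactly \<open>base_gf_nth_rec\<close>, and both sides are 1 on
  the empty set. Strong induction is used because the recurrence goes back two steps.\<close>

lemma odd_cycle_poly_odd: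
  assumes "finite S"
  shows "odd_cycle_poly S (of_nat (2 * m + 1)) = fact (card S) * (base_gf (card S) $ m :: 'a::field_char_0)"
  using assms
proof (induction "card S" arbitrary: S rule: less_induct)
  case less
  show ?case
  proof (cases "S = {}")
    case True
    then show ?thesis by (simp add: odd_cycle_poly_def num_odd_def base_gf_0)
  next
    case False
    then obtain a R where R: "S = insert a R" "a \<notin> R" by (meson mk_disjoint_insert ex_in_conv)
    then have fR: "finite R" using less.prems by simp
    define n where "n = card R"
    have cS: "card S = Suc n" using R fR by (simp add: n_def)
    have IH: "odd_cycle_poly T (of_nat (2 * m + 1)) = fact (card T) * (base_gf (card T) $ m :: 'a)"
      if "T \<subseteq> R" for T
      using that fR R less.hyps[of T] cS n_def card_mono[OF fR that] finite_subset[OF that] by simp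
    have "(\<Sum>b\<in>R. odd_cycle_poly (R - {b}) (of_nat (2 * m + 1)))
      = (\<Sum>b\<in>R. fact (n - 1) * (base_gf (n - 1) $ m :: 'a))"
      by (intro sum.cong refl) (subst IH, use fR n_def in auto)
    then have "odd_cycle_poly S (of_nat (2 * m + 1))
      = of_nat (2 * m + 1) * (fact n * base_gf n $ m)
        + of_nat n * (of_nat n * (fact (n - 1) * (base_gf (n - 1) $ m :: 'a)))"
      using odd_cycle_poly_insert[OF fR R(2), of "of_nat (2 * m + 1) :: 'a"] IH[of R] R(1) n_def
      by simp
    also have "of_nat n * (of_nat n * (fact (n - 1) * (base_gf (n - 1) $ m :: 'a)))
      = fact n * (of_nat n * (base_gf (n - 1) $ m))"
      by (cases n) (simp_all add: ac_simps)
    also have "of_nat (2 * m + 1) * (fact n * base_gf n $ m) + fact n * (of_nat n * (base_gf (n - 1) $ m))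
      = fact n * (of_nat (2 * m + 1) * base_gf n $ m + of_nat n * (base_gf (n - 1) $ m) :: 'a)"
      by (simp only: distrib_left ac_simps)
    also have "\<dots> = fact n * (of_nat (Suc n) * base_gf (Suc n) $ m)"
      unfolding base_gf_nth_rec ..
    finally show ?thesis unfolding cS by (simp only: fact_Suc ac_simps)
  qed
qed

section \<open>Left enriched partitions\<close>

text \<open>The bound \<open>k\<close> may have either parity, although the final counts use odd
  bounds only: removing the last position produces both kinds of bounds.\<close>

definition enriched :: "nat \<Rightarrow> nat \<Rightarrow> (nat \<Rightarrow> nat) \<Rightarrow> (nat \<Rightarrow> nat) set" where
  "enriched n k p = {g \<in> {1..n} \<rightarrow>\<^sub>E {..<k}.
    \<forall>i\<in>{1..<n}. g i < g (Suc i) \<or> g i = g (Suc i) \<and> (even (g i) \<longleftrightarrow> p i < p (Suc i))}"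

lemma finite_enriched: "finite (enriched n k p)"
  unfolding enriched_def by (rule finite_subset[of _ "{1..n} \<rightarrow>\<^sub>E {..<k}"]) (auto intro: finite_PiE)

lemma enriched_mono:
  assumes "g \<in> enriched n k p" "1 \<le> i" "i \<le> j" "j \<le> n"
  shows "g i \<le> g j"
  using assms(3,4)
proof (induction j rule: dec_induct)
  case (step j)
  then have "j \<in> {1..<n}" using assms(2) by auto
  then have "g j \<le> g (Suc j)" using assms(1) unfolding enriched_def by force
  then show ?case using step by simp
qed simp

lemma card_enriched_0: "card (enriched 0 k p) = 1"
  by (simp add: enriched_def)

text \<open>Split by the last value \<open>c\<close>. The value before it may equal \<open>c\<close>
  only if the parity of \<open>c\<close> suits the step from \<open>n\<close> to
  \<open>Suc n\<close>, and by monotonicity the bound on \<open>g n\<close> bounds all earlier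
  values. For \<open>n = 0\<close> the comparison of \<open>p 0\<close> with \<open>p 1\<close> is
  immaterial, since either bound gives count 1.\<close>

lemma card_enriched_Suc:
  "card (enriched (Suc n) k p)
    = (\<Sum>c<k. card (enriched n (if even c \<longleftrightarrow> p n < p (Suc n) then Suc c else c) p))"
proof -
  let ?K = "\<lambda>c. if even c \<longleftrightarrow> p n < p (Suc n) then Suc c else c"
  have "bij_betw (\<lambda>g. (g (Suc n), g(Suc n := undefined))) (enriched (Suc n) k p)
    (SIGMA c:{..<k}. enriched n (?K c) p)"
  proof (rule bij_betw_byWitness[where f' = "\<lambda>(c, g). g(Suc n := c)"])
    show "\<forall>g\<in>enriched (Suc n) k p.
        (\<lambda>(c, g). g(Suc n := c)) (g (Suc n), g(Suc n := undefined)) = g" by simp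
    show "\<forall>x\<in>SIGMA c:{..<k}. enriched n (?K c) p. (\<lambda>g. (g (Suc n), g(Suc n := undefined)))
        ((\<lambda>(c, g). g(Suc n := c)) x) = x"
      by (auto simp: enriched_def PiE_def extensional_def fun_eq_iff)
    show "(\<lambda>g. (g (Suc n), g(Suc n := undefined))) ` enriched (Suc n) k p
      \<subseteq> (SIGMA c:{..<k}. enriched n (?K c) p)"
    proof (rule image_subsetI)
      fix g assume g: "g \<in> enriched (Suc n) k p"
      have "g i < ?K (g (Suc n))" if i: "i \<in> {1..n}" for i
      proof -
        have "g i \<le> g n" using enriched_mono[OF g] i by auto
        moreover have "n \<in> {1..<Suc n}" using i by auto
        then have "g n < g (Suc n) \<or> g n = g (Suc n) \<and> (even (g n) \<longleftrightarrow> p n < p (Suc n))"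
          using g unfolding enriched_def by blast
        ultimately show ?thesis by auto
      qed
      then show "(g (Suc n), g(Suc n := undefined)) \<in> (SIGMA c:{..<k}. enriched n (?K c) p)"
        using g unfolding enriched_def by (auto simp: PiE_def Pi_def extensional_def)
    qed
    show "(\<lambda>(c, g). g(Suc n := c)) ` (SIGMA c:{..<k}. enriched n (?K c) p) \<subseteq> enriched (Suc n) k p"
    proof (rule image_subsetI)
      fix x assume "x \<in> (SIGMA c:{..<k}. enriched n (?K c) p)"
      then obtain c g where x: "x = (c, g)" and c: "c \<in> {..<k}" and g: "g \<in> enriched n (?K c) p"
        by blast
      have lt: "g i < ?K c" if "i \<in> {1..n}" for i
        using g that unfolding enriched_def by blast
      have ck: "?K c \<le> k" using c by auto
      have "g(Suc n := c) \<in> {1..Suc n} \<rightarrow>\<^sub>E {..<k}"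
        using g c less_le_trans[OF lt ck] by (auto simp: enriched_def PiE_def Pi_def extensional_def)
      moreover have "(g(Suc n := c)) i < (g(Suc n := c)) (Suc i) \<or> (g(Suc n := c)) i = (g(Suc n := c)) (Suc i)
          \<and> (even ((g(Suc n := c)) i) \<longleftrightarrow> p i < p (Suc i))" if i: "i \<in> {1..<Suc n}" for i
      proof (cases "i = n")
        case True
        then show ?thesis using lt[of n] i by (auto split: if_splits simp: less_Suc_eq)
      next
        case False
        then have "i \<in> {1..<n}" using i by auto
        then show ?thesis using g unfolding enriched_def by auto
      qed
      ultimately have "g(Suc n := c) \<in> enriched (Suc n) k p" unfolding enriched_def by blast
      then show "(\<lambda>(c, g). g(Suc n := c)) x \<in> enriched (Suc n) k p" by (simp add: x)
    qed
  qed
  then have "card (enriched (Suc n) k p) = card (SIGMA c:{..<k}. enriched n (?K c) p)"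
    by (rule bij_betw_same_card)
  then show ?thesis by (simp add: finite_enriched)
qed


section \<open>Generating functions along ascents and descents\<close>

context
  fixes p :: "nat \<Rightarrow> nat"
begin

text \<open>
  At an ascent only the counts with an odd bound matter, at a descent only those with an even
  bound; switching from the former to the latter costs the factor that defines \<open>peak_gf\<close>.
\<close>

private definition F :: "nat \<Rightarrow> 'a::field fps" where
  "F n = Abs_fps (\<lambda>a. of_nat (card (enriched n (2 * a + 1) p)))"

private definition G :: "nat \<Rightarrow> 'a::field fps" where
  "G n = Abs_fps (\<lambda>a. of_nat (card (enriched n (2 * a + 2) p)))"

text \<open>The last letters \<open>2 * j\<close> and \<open>2 * j + 1\<close> both leave the bound
  \<open>2 * j + 1\<close>. Multiplying by \<open>1 - fps_X\<close> takes differences of the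
  resulting partial sums, so only the topmost letters survive.\<close>

private lemma gf_asc:
  assumes "p n < p (Suc n)"
  shows "F (Suc n) = inverse (1 - fps_X) * (1 + fps_X) * F n"
    and "G (Suc n) = inverse (1 - fps_X) * 2 * F n"
proof -
  have "(1 - fps_X) * F (Suc n) = (1 + fps_X) * F n"
  proof (rule fps_ext)
    fix m show "((1 - fps_X) * F (Suc n)) $ m = ((1 + fps_X) * F n) $ m"
      by (cases m) (use assms in \<open>simp_all add: F_def card_enriched_Suc algebra_simps\<close>)
  qed
  from eq_inverse_one_minus_fps_X[OF this]
  show "F (Suc n) = inverse (1 - fps_X) * (1 + fps_X) * F n" by (simp only: mult.assoc)
  have "(1 - fps_X) * G (Suc n) = F n + F n"
  proof (rule fps_ext)
    fix m show "((1 - fps_X) * G (Suc n)) $ m = (F n + F n) $ m"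
      by (cases m) (use assms in \<open>simp_all add: F_def G_def card_enriched_Suc fps_two_mult_nth algebra_simps\<close>)
  qed
  from eq_inverse_one_minus_fps_X[OF this]
  show "G (Suc n) = inverse (1 - fps_X) * 2 * F n" by (simp only: mult.assoc mult_2)
qed

text \<open>Here the last letters \<open>2 * j + 1\<close> and \<open>2 * j + 2\<close> both leave
  the bound \<open>2 * j + 2\<close>, while the letter 0 leaves the bound 0. The latter contributes
  nothing because \<open>n \<ge> 1\<close>.\<close>

private lemma gf_desc:
  assumes "\<not> p n < p (Suc n)" "n \<ge> 1"
  shows "F (Suc n) = inverse (1 - fps_X) * (2 * fps_X) * G n"
    and "G (Suc n) = inverse (1 - fps_X) * (1 + fps_X) * G n"
proof -
  have 0: "card (enriched n 0 p) = 0" using assms(2) by (cases n) (simp_all add: card_enriched_Suc)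
  have "(1 - fps_X) * F (Suc n) = fps_X * (G n + G n)"
  proof (rule fps_ext)
    fix m show "((1 - fps_X) * F (Suc n)) $ m = (fps_X * (G n + G n)) $ m"
      by (cases m) (use assms 0 in \<open>simp_all add: F_def G_def card_enriched_Suc fps_two_mult_nth algebra_simps\<close>)
  qed
  from eq_inverse_one_minus_fps_X[OF this]
  show "F (Suc n) = inverse (1 - fps_X) * (2 * fps_X) * G n" by (simp add: algebra_simps)
  have "(1 - fps_X) * G (Suc n) = (1 + fps_X) * G n"
  proof (rule fps_ext)
    fix m show "((1 - fps_X) * G (Suc n)) $ m = ((1 + fps_X) * G n) $ m"
      by (cases m) (use assms 0 in \<open>simp_all add: F_def G_def card_enriched_Suc fps_two_mult_nth algebra_simps\<close>)
  qed
  from eq_inverse_one_minus_fps_X[OF this]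
  show "G (Suc n) = inverse (1 - fps_X) * (1 + fps_X) * G n" by (simp only: mult.assoc)
qed

text \<open>The index 1 is compared with \<open>p 0\<close>. A permutation of \<open>{1..n}\<close>
  fixes 0, so a descent at position 1 counts as an ordinary peak; this absorbs the special clause
  for left peaks.\<close>

private definition pk :: "nat \<Rightarrow> nat" where
  "pk n = card {i \<in> {1..<n}. p (i - 1) < p i \<and> \<not> p i < p (Suc i)}"

private lemma pk_Suc:
  "pk (Suc n) = pk n + (if n \<ge> 1 \<and> p (n - 1) < p n \<and> \<not> p n < p (Suc n) then 1 else 0)"
proof -
  let ?P = "\<lambda>i. p (i - 1) < p i \<and> \<not> p i < p (Suc i)"
  have "{i \<in> {1..<Suc n}. ?P i} = {i \<in> {1..<n}. ?P i} \<union> (if n \<ge> 1 \<and> ?P n then {n} else {})"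
    by (auto simp: less_Suc_eq)
  then show ?thesis by (simp add: pk_def card_insert_if)
qed

text \<open>The second conjunct carries the relation between \<open>F\<close> and \<open>G\<close>
  left by the last step. A step that completes no peak multiplies \<open>F\<close> by
  \<open>(1 + x) / (1 - x)\<close>, the step factor of \<open>base_gf\<close>. A descent after an
  ascent gives \<open>2 * x / (1 - x) * G\<close> with \<open>G = 2 * F / (1 + x)\<close>, which is
  the same factor times \<open>peak_gf\<close>.\<close>

private lemma F_eq:
  assumes "p 0 < p 1"
  shows "F n = base_gf n * (peak_gf :: 'a fps) ^ pk n \<and> (n \<ge> 1 \<longrightarrow>
    (if p (n - 1) < p n then (1 + fps_X) * G n = 2 * (F n :: 'a fps)
     else (1 + fps_X) * F n = 2 * fps_X * (G n :: 'a::field fps)))"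
proof (induction n)
  case 0
  show ?case by (simp add: F_def card_enriched_0 pk_def base_gf_0)
next
  case (Suc n)
  let ?u = "inverse (1 - fps_X) :: 'a fps" and ?v = "inverse (1 + fps_X) :: 'a fps"
  show ?case
  proof (cases "p n < p (Suc n)")
    case True
    have "F (Suc n) = base_gf (Suc n) * (peak_gf :: 'a fps) ^ pk (Suc n)"
      using Suc.IH True by (simp add: gf_asc[OF True] pk_Suc base_gf_Suc algebra_simps)
    moreover have "(1 + fps_X) * G (Suc n) = 2 * (F (Suc n) :: 'a fps)"
      by (simp add: gf_asc[OF True] algebra_simps)
    ultimately show ?thesis using True by simp
  next
    case False
    then have n: "n \<ge> 1" using assms by (cases n) auto
    have "F (Suc n) = base_gf (Suc n) * (peak_gf :: 'a fps) ^ pk (Suc n)"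
    proof (cases "p (n - 1) < p n")
      case True
      have "G n = ((1 + fps_X) * ?v) * G n" by (simp add: one_plus_fps_X_inverse)
      also have "\<dots> = ?v * ((1 + fps_X) * G n)" by (simp only: ac_simps)
      also have "\<dots> = ?v * (2 * F n)" using Suc.IH n True by simp
      finally have "F (Suc n) = ?u * (2 * fps_X) * (?v * (2 * F n))"
        by (simp add: gf_desc[OF False n])
      also have "\<dots> = ?u * (4 * fps_X) * (((1 + fps_X) * ?v) * ?v) * F n"
        by (simp add: one_plus_fps_X_inverse)
      also have "\<dots> = (1 + fps_X) * ?u * peak_gf * F n"
        by (simp only: peak_gf_def power2_eq_square ac_simps)
      finally show ?thesis using Suc.IH n True False by (simp add: pk_Suc base_gf_Suc ac_simps)
    next
      case nasc: False
      have "F (Suc n) = ?u * (2 * fps_X * G n)"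
        by (simp add: gf_desc[OF False n] ac_simps)
      also have "\<dots> = ?u * ((1 + fps_X) * F n)" using conjunct2[OF Suc.IH] n nasc by simp
      finally show ?thesis using Suc.IH n nasc False by (simp add: pk_Suc base_gf_Suc ac_simps)
    qed
    moreover have "(1 + fps_X) * F (Suc n) = 2 * fps_X * (G (Suc n) :: 'a fps)"
      by (simp only: gf_desc[OF False n] ac_simps)
    ultimately show ?thesis using False by simp
  qed
qed

private lemma lpk_eq_pk:
  assumes p: "p permutes {1..n}"
  shows "lpk n p = pk n"
proof -
  have 0: "p 0 = 0" using permutes_not_in[OF p, of 0] by simp
  have "is_left_peak n p i \<longleftrightarrow> i \<in> {1..<n} \<and> p (i - 1) < p i \<and> \<not> p i < p (Suc i)" for i
  proof (cases "i \<in> {1..<n}")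
    case True
    have "p i \<noteq> p (Suc i)" using permutes_inj[OF p] by (metis inj_eq n_not_Suc_n)
    moreover have "p i \<ge> 1" using permutes_in_image[OF p, of i] True by auto
    ultimately show ?thesis using True 0
      by (cases "i = 1") (auto simp: is_left_peak_def is_peak_def numeral_2_eq_2)
  next
    case False
    then show ?thesis by (auto simp: is_left_peak_def)
  qed
  then show ?thesis by (simp add: lpk_def pk_def)
qed

lemma enriched_gf:
  assumes p: "p permutes {1..n}"
  shows "Abs_fps (\<lambda>a. of_nat (card (enriched n (2 * a + 1) p)))
    = base_gf n * (peak_gf :: 'a::field fps) ^ lpk n p"
proof (cases n)
  case 0
  then show ?thesis using lpk_eq_pk[OF p] by (simp add: card_enriched_0 pk_def base_gf_0)
next
  case (Suc m)
  then have "p 0 < p 1"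
    using permutes_not_in[OF p, of 0] permutes_in_image[OF p, of 1] by auto
  from F_eq[OF this, of n, where 'a = 'a] show ?thesis using lpk_eq_pk[OF p] by (simp add: F_def)
qed

end

section \<open>Standardization of words\<close>

text \<open>Lexicographic order as a single number: first the letter, then the position, taken from
  right to left for odd letters. The base \<open>Suc n\<close> leaves room for the tie-breaker,
  which is at most \<open>n\<close> on positions.\<close>

definition word_key :: "nat \<Rightarrow> (nat \<Rightarrow> nat) \<Rightarrow> nat \<Rightarrow> nat" where
  "word_key n w i = w i * Suc n + (if even (w i) then i else n - i)"

lemma mult_add_less_iff:
  fixes a b q r N :: nat
  assumes "q < N" "r < N"
  shows "a * N + q < b * N + r \<longleftrightarrow> a < b \<or> a = b \<and> q < r"
proof (cases a b rule: linorder_cases)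
  case less
  then have "Suc a * N \<le> b * N" by (intro mult_le_mono1) simp
  then show ?thesis using less assms by simp
next
  case greater
  then have "Suc b * N \<le> a * N" by (intro mult_le_mono1) simp
  then show ?thesis using greater assms by simp
qed simp

lemma word_key_less_iff:
  assumes "i \<in> {1..n}" "j \<in> {1..n}"
  shows "word_key n w i < word_key n w j \<longleftrightarrow> w i < w j \<or> w i = w j \<and> (if even (w i) then i < j else j < i)"
proof -
  have "word_key n w i < word_key n w j \<longleftrightarrow> w i < w j \<or> w i = w j \<and>
    (if even (w i) then i else n - i) < (if even (w j) then j else n - j)"
    unfolding word_key_def by (rule mult_add_less_iff) (use assms in auto)
  then show ?thesis using assms by auto
qed

lemma inj_on_word_key: "inj_on (word_key n w) {1..n}"
proof (rule inj_onI)
  fix i j assume ij: "i \<in> {1..n}" "j \<in> {1..n}" and "word_key n w i = word_key n w j"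
  then have "\<not> word_key n w i < word_key n w j" "\<not> word_key n w j < word_key n w i" by auto
  then show "i = j" unfolding word_key_less_iff[OF ij] word_key_less_iff[OF ij(2,1)]
    by (auto split: if_splits)
qed

lemma strict_mono_on_iff_adjacent:
  fixes f :: "nat \<Rightarrow> 'a::order"
  shows "strict_mono_on {1..n} f \<longleftrightarrow> (\<forall>i\<in>{1..<n}. f i < f (Suc i))"
proof
  assume R: "\<forall>i\<in>{1..<n}. f i < f (Suc i)"
  have "f i < f j" if "1 \<le> i" "Suc i \<le> j" "j \<le> n" for i j
    using that(2,3)
  proof (induction j rule: dec_induct)
    case base
    then show ?case using R that by auto
  next
    case (step j)
    then have "f j < f (Suc j)" using R that(1) by auto
    then show ?case using step by (auto intro: less_trans)
  qed
  then show "strict_mono_on {1..n} f" by (auto intro!: strict_mono_onI)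
qed (auto intro!: strict_mono_onD[of "{1..n}" f])

text \<open>A tie between neighbours \<open>\<sigma> i\<close> and \<open>\<sigma> (Suc i)\<close>
  is in key order exactly if they ascend at an even letter or descend at an odd one. This is the
  enriched condition, so it says that \<open>\<sigma>\<close> sorts the positions by key.\<close>

lemma enriched_comp_iff:
  assumes \<sigma>: "\<sigma> permutes {1..n}" and w: "w \<in> {1..n} \<rightarrow>\<^sub>E {..<l}"
  shows "w \<circ> \<sigma> \<in> enriched n l \<sigma> \<longleftrightarrow> strict_mono_on {1..n} (word_key n w \<circ> \<sigma>)"
proof -
  have "w \<circ> \<sigma> \<in> {1..n} \<rightarrow>\<^sub>E {..<l}"
    using w permutes_in_image[OF \<sigma>] permutes_not_in[OF \<sigma>]
    by (fastforce simp: PiE_def Pi_def extensional_def)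
  moreover have "(word_key n w \<circ> \<sigma>) i < (word_key n w \<circ> \<sigma>) (Suc i) \<longleftrightarrow>
    (w \<circ> \<sigma>) i < (w \<circ> \<sigma>) (Suc i) \<or> (w \<circ> \<sigma>) i = (w \<circ> \<sigma>) (Suc i) \<and>
      (even ((w \<circ> \<sigma>) i) \<longleftrightarrow> \<sigma> i < \<sigma> (Suc i))" if "i \<in> {1..<n}" for i
  proof -
    have "\<sigma> i \<in> {1..n}" "\<sigma> (Suc i) \<in> {1..n}"
      using that permutes_in_image[OF \<sigma>] by auto
    moreover have "\<sigma> i \<noteq> \<sigma> (Suc i)"
      using permutes_inj[OF \<sigma>] by (metis inj_eq n_not_Suc_n)
    ultimately show ?thesis
      by (auto simp: word_key_less_iff)
  qed
  ultimately show ?thesis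
    unfolding enriched_def strict_mono_on_iff_adjacent by blast
qed

section \<open>Sorting permutations and ranks\<close>

lemma rank_less:
  fixes key :: "'b \<Rightarrow> 'a::linorder"
  assumes "finite A" "y \<in> A" "key x < key y"
  shows "card {j \<in> A. key j \<le> key x} < card {j \<in> A. key j \<le> key y}"
proof (rule psubset_card_mono)
  have "y \<notin> {j \<in> A. key j \<le> key x}" "y \<in> {j \<in> A. key j \<le> key y}" using assms by auto
  moreover have "{j \<in> A. key j \<le> key x} \<subseteq> {j \<in> A. key j \<le> key y}" using assms by auto
  ultimately show "{j \<in> A. key j \<le> key x} \<subset> {j \<in> A. key j \<le> key y}" by blast
qed (use assms in simp)

text \<open>The inverse of the ranking map sorts. Conversely, a sorting permutation must send
  \<open>i\<close> to the element of rank \<open>i\<close>, and distinct elements have distinct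
  ranks.\<close>

lemma ex1_sorting_permutation:
  fixes key :: "nat \<Rightarrow> 'a::linorder"
  assumes "inj_on key {1..n}"
  shows "\<exists>!\<sigma>. \<sigma> permutes {1..n} \<and> strict_mono_on {1..n} (key \<circ> \<sigma>)"
proof (rule ex_ex1I)
  define rank where "rank i = (if i \<in> {1..n} then card {j \<in> {1..n}. key j \<le> key i} else i)" for i
  have mono: "rank i < rank j" if "i \<in> {1..n}" "j \<in> {1..n}" "key i < key j" for i j
    using that rank_less[of "{1..n}" j key i] by (simp add: rank_def)
  have in_n: "rank i \<in> {1..n}" if "i \<in> {1..n}" for i
  proof -
    have "card {j \<in> {1..n}. key j \<le> key i} \<le> card {1..n}" by (intro card_mono) auto
    moreover have "{j \<in> {1..n}. key j \<le> key i} \<noteq> {}" using that by auto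
    then have "card {j \<in> {1..n}. key j \<le> key i} > 0" by (subst card_gt_0_iff) auto
    ultimately show ?thesis using that by (simp add: rank_def)
  qed
  have "inj_on rank {1..n}"
  proof (rule inj_onI)
    fix i j assume "i \<in> {1..n}" "j \<in> {1..n}" "rank i = rank j"
    then show "i = j" using mono[of i j] mono[of j i] inj_onD[OF assms, of i j]
      by (cases "key i" "key j" rule: linorder_cases) simp_all
  qed
  then have "bij_betw rank {1..n} {1..n}"
    using in_n by (intro bij_betw_imageI endo_inj_surj) auto
  then have rank: "rank permutes {1..n}" by (rule bij_imp_permutes) (auto simp: rank_def)
  then have inv: "inv rank permutes {1..n}" by (rule permutes_inv)
  have "strict_mono_on {1..n} (key \<circ> inv rank)"
  proof (rule strict_mono_onI)
    fix r s assume rs: "r \<in> {1..n}" "s \<in> {1..n}" "r < s"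
    have "\<not> key (inv rank s) < key (inv rank r)"
      using mono[of "inv rank s" "inv rank r"] rs permutes_in_image[OF inv] permutes_inverses[OF rank] by auto
    moreover have "key (inv rank s) \<noteq> key (inv rank r)"
      using inj_on_contraD[OF assms, of "inv rank s" "inv rank r"] rs permutes_in_image[OF inv]
        inj_eq[OF permutes_inj[OF inv]] by simp
    ultimately show "(key \<circ> inv rank) r < (key \<circ> inv rank) s" by auto
  qed
  with inv show "\<exists>\<sigma>. \<sigma> permutes {1..n} \<and> strict_mono_on {1..n} (key \<circ> \<sigma>)" by blast
next
  fix \<sigma> \<tau>
  assume \<sigma>: "\<sigma> permutes {1..n} \<and> strict_mono_on {1..n} (key \<circ> \<sigma>)"
    and \<tau>: "\<tau> permutes {1..n} \<and> strict_mono_on {1..n} (key \<circ> \<tau>)"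
  have rank: "card {j \<in> {1..n}. key j \<le> key (\<rho> i)} = i"
    if \<rho>: "\<rho> permutes {1..n}" "strict_mono_on {1..n} (key \<circ> \<rho>)" and i: "i \<in> {1..n}" for \<rho> i
  proof -
    have "key (\<rho> j) \<le> key (\<rho> i) \<longleftrightarrow> j \<le> i" if "j \<in> {1..n}" for j
      using strict_mono_on_less_eq[OF \<rho>(2) that i] by simp
    then have "\<rho> ` {1..i} = {j \<in> \<rho> ` {1..n}. key j \<le> key (\<rho> i)}" using i by auto
    then have "{j \<in> {1..n}. key j \<le> key (\<rho> i)} = \<rho> ` {1..i}"
      using permutes_image[OF \<rho>(1)] by simp
    moreover have "card (\<rho> ` {1..i}) = i"
      using card_image[OF inj_on_subset[OF permutes_inj[OF \<rho>(1)]]] by simp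
    ultimately show ?thesis by simp
  qed
  have mono: "card {j \<in> {1..n}. key j \<le> key x} < card {j \<in> {1..n}. key j \<le> key y}"
    if "x \<in> {1..n}" "y \<in> {1..n}" "key x < key y" for x y
    using that rank_less[of "{1..n}"] by simp
  have "\<sigma> i = \<tau> i" for i
  proof (cases "i \<in> {1..n}")
    case True
    then have in_n: "\<sigma> i \<in> {1..n}" "\<tau> i \<in> {1..n}"
      using permutes_in_image[OF conjunct1[OF \<sigma>]] permutes_in_image[OF conjunct1[OF \<tau>]] by auto
    then have "key (\<sigma> i) = key (\<tau> i)"
      using rank[of \<sigma> i] rank[of \<tau> i] mono[of "\<sigma> i" "\<tau> i"] mono[of "\<tau> i" "\<sigma> i"] \<sigma> \<tau> True
      by (cases "key (\<sigma> i)" "key (\<tau> i)" rule: linorder_cases) auto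
    then show ?thesis using in_n inj_onD[OF assms] by simp
  next
    case False
    then show ?thesis
      using permutes_not_in[OF conjunct1[OF \<sigma>]] permutes_not_in[OF conjunct1[OF \<tau>]] by simp
  qed
  then show "\<sigma> = \<tau>" by auto
qed

text \<open>This is the inverse of the usual standardization: \<open>std n w\<close> lists positions
  in sorted order, while \<open>inv (std n w)\<close> assigns to each position its rank.\<close>

definition std :: "nat \<Rightarrow> (nat \<Rightarrow> nat) \<Rightarrow> nat \<Rightarrow> nat" where
  "std n w = (THE \<sigma>. \<sigma> permutes {1..n} \<and> strict_mono_on {1..n} (word_key n w \<circ> \<sigma>))"

lemma std:
  "std n w permutes {1..n}" "strict_mono_on {1..n} (word_key n w \<circ> std n w)"
  "\<sigma> permutes {1..n} \<Longrightarrow> strict_mono_on {1..n} (word_key n w \<circ> \<sigma>) \<Longrightarrow> \<sigma> = std n w"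
proof -
  note ex1 = ex1_sorting_permutation[OF inj_on_word_key[of n w]]
  from theI'[OF ex1]
  show 1: "std n w permutes {1..n}" "strict_mono_on {1..n} (word_key n w \<circ> std n w)"
    unfolding std_def by blast+
  show "\<sigma> permutes {1..n} \<Longrightarrow> strict_mono_on {1..n} (word_key n w \<circ> \<sigma>) \<Longrightarrow> \<sigma> = std n w"
    using ex1 1 by blast
qed

text \<open>Ranks compare as keys do, and for adjacent positions a tie is decided by the parity of
  the letter alone. This turns a condition on the inverse permutation into one on the word.\<close>

lemma inv_std_less_iff:
  assumes i: "i \<in> {1..<n}"
  shows "inv (std n w) i < inv (std n w) (Suc i) \<longleftrightarrow> w i < w (Suc i) \<or> w i = w (Suc i) \<and> even (w i)"
proof -
  let ?\<tau> = "inv (std n w)"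
  have \<tau>: "?\<tau> permutes {1..n}" using std(1) by (rule permutes_inv)
  have "?\<tau> i \<in> {1..n}" "?\<tau> (Suc i) \<in> {1..n}" using i permutes_in_image[OF \<tau>] by auto
  from strict_mono_on_less[OF std(2)[of n w] this]
  have "?\<tau> i < ?\<tau> (Suc i) \<longleftrightarrow> word_key n w i < word_key n w (Suc i)"
    using permutes_inverses[OF std(1)[of n w]] by simp
  then show ?thesis using i by (simp add: word_key_less_iff)
qed

text \<open>By \<open>enriched_comp_iff\<close>, composing with \<open>\<sigma>\<close> maps the
  fibre of \<open>std n\<close> over \<open>\<sigma>\<close> bijectively onto the enriched maps of
  \<open>\<sigma>\<close>. The weight \<open>\<phi>\<close> is kept general: the constant 1 counts
  all words, and a count for \<open>inv \<sigma>\<close> gives the joint identity.\<close>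

lemma sum_enriched_eq_sum_words:
  fixes \<phi> :: "(nat \<Rightarrow> nat) \<Rightarrow> 'a::comm_semiring_1"
  shows "(\<Sum>\<sigma> | \<sigma> permutes {1..n}. of_nat (card (enriched n l \<sigma>)) * \<phi> \<sigma>)
    = (\<Sum>w\<in>{1..n} \<rightarrow>\<^sub>E {..<l}. \<phi> (std n w))"
proof -
  let ?W = "{1..n} \<rightarrow>\<^sub>E {..<l}" and ?P = "{\<sigma>. \<sigma> permutes {1..n}}"
  have finW: "finite ?W" by (intro finite_PiE) auto
  have finP: "finite ?P" by (intro finite_permutations) auto
  have card: "card (enriched n l \<sigma>) = card {w \<in> ?W. std n w = \<sigma>}" if \<sigma>: "\<sigma> \<in> ?P" for \<sigma>
  proof -
    have p: "\<sigma> permutes {1..n}" using \<sigma> by simp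
    have comp: "g \<circ> \<rho> \<in> ?W" if "g \<in> ?W" "\<rho> permutes {1..n}" for g \<rho>
      using that(1) permutes_in_image[OF that(2)] permutes_not_in[OF that(2)]
      by (fastforce simp: PiE_def Pi_def extensional_def)
    have eq: "std n w = \<sigma> \<longleftrightarrow> w \<circ> \<sigma> \<in> enriched n l \<sigma>" if "w \<in> ?W" for w
      using enriched_comp_iff[OF p that] std(2)[of n w] std(3)[OF p, of w] by auto
    have "bij_betw (\<lambda>w. w \<circ> \<sigma>) {w \<in> ?W. std n w = \<sigma>} (enriched n l \<sigma>)"
    proof (rule bij_betw_byWitness[where f' = "\<lambda>g. g \<circ> inv \<sigma>"])
      show "(\<lambda>w. w \<circ> \<sigma>) ` {w \<in> ?W. std n w = \<sigma>} \<subseteq> enriched n l \<sigma>" using eq by auto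
      show "(\<lambda>g. g \<circ> inv \<sigma>) ` enriched n l \<sigma> \<subseteq> {w \<in> ?W. std n w = \<sigma>}"
      proof (rule image_subsetI)
        fix g assume g: "g \<in> enriched n l \<sigma>"
        then have "g \<circ> inv \<sigma> \<in> ?W"
          by (intro comp permutes_inv p) (simp add: enriched_def)
        moreover have "(g \<circ> inv \<sigma>) \<circ> \<sigma> = g" using permutes_inv_o[OF p] by (simp add: o_assoc[symmetric])
        ultimately show "g \<circ> inv \<sigma> \<in> {w \<in> ?W. std n w = \<sigma>}" using eq g by auto
      qed
    qed (use permutes_inv_o[OF p] in \<open>auto simp: o_assoc[symmetric]\<close>)
    then show ?thesis by (simp add: bij_betw_same_card)
  qed
  have "(\<Sum>\<sigma>\<in>?P. of_nat (card (enriched n l \<sigma>)) * \<phi> \<sigma>)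
    = (\<Sum>\<sigma>\<in>?P. \<Sum>w\<in>{w \<in> ?W. std n w = \<sigma>}. \<phi> (std n w))"
    by (intro sum.cong refl) (simp add: card)
  also have "\<dots> = (\<Sum>w\<in>?W. \<phi> (std n w))"
    by (rule sum.group[OF finW finP]) (use std(1) in auto)
  finally show ?thesis .
qed

lemma sum_card_enriched: "(\<Sum>\<sigma> | \<sigma> permutes {1..n}. card (enriched n l \<sigma>)) = l ^ n"
  using sum_enriched_eq_sum_words[of n l "\<lambda>_. 1::nat"] by (simp add: card_PiE)

section \<open>Snake order on pairs of letters\<close>

definition snake :: "nat \<Rightarrow> nat \<Rightarrow> nat \<Rightarrow> nat" where
  "snake l i j = i * l + (if even i then j else l - 1 - j)"

lemma snake:
  assumes "j < l"
  shows "snake l i j div l = i" "snake l i j mod l = (if even i then j else l - 1 - j)"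
  using assms by (auto simp: snake_def)

lemma snake_inverse:
  assumes "l > 0"
  shows "snake l (h div l) (if even (h div l) then h mod l else l - 1 - h mod l) = h"
proof -
  have "h mod l < l" using assms by simp
  then have "l - 1 - (l - 1 - h mod l) = h mod l" by simp
  then show ?thesis by (simp add: snake_def)
qed

text \<open>For odd \<open>l\<close> the parities of the cell numbers form a checkerboard: a cell is
  even exactly if row and column have equal parity. Hence the rule for adjacent letters at an
  ascent, read on cell numbers, becomes a comparison of rows whose ties are decided by the column
  rule, negated in odd rows.\<close>

lemma snake_order:
  assumes "odd l" "j < l" "j' < l"
  shows "(snake l i j < snake l i' j' \<or> snake l i j = snake l i' j' \<and> even (snake l i j)) \<longleftrightarrow>
    (i < i' \<or> i = i' \<and> (even i \<longleftrightarrow> (j < j' \<or> j = j' \<and> even j)))"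
proof -
  have par: "even (snake l i j) \<longleftrightarrow> (even i \<longleftrightarrow> even j)"
    using assms by (auto simp: snake_def)
  have less: "snake l a b < snake l a' b' \<longleftrightarrow> a < a' \<or> a = a' \<and>
    (if even a then b < b' else b' < b)" if "b < l" "b' < l" for a b a' b'
  proof -
    have "snake l a b < snake l a' b' \<longleftrightarrow> a < a' \<or> a = a' \<and>
      (if even a then b else l - 1 - b) < (if even a' then b' else l - 1 - b')"
      unfolding snake_def by (rule mult_add_less_iff) (use that in auto)
    then show ?thesis using that by auto
  qed
  \<comment> \<open>Injectivity follows from the description of the order by trichotomy.\<close>
  have "snake l i j = snake l i' j' \<longleftrightarrow> \<not> snake l i j < snake l i' j' \<and> \<not> snake l i' j' < snake l i j"
    by auto
  also have "\<dots> \<longleftrightarrow> i = i' \<and> j = j'"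
    using assms by (auto simp: less split: if_splits)
  finally have "snake l i j = snake l i' j' \<longleftrightarrow> i = i' \<and> j = j'" .
  with less[OF assms(2,3)] par assms show ?thesis by auto
qed

text \<open>A word \<open>w\<close> supplies columns and a map \<open>f\<close> enriched for
  \<open>inv (std n w)\<close> supplies rows. By \<open>inv_std_less_iff\<close>, the column rule in
  \<open>snake_order\<close> is an ascent of \<open>inv (std n w)\<close>, so the merged map is
  enriched for the identity exactly if \<open>f\<close> is enriched for
  \<open>inv (std n w)\<close>.\<close>

lemma sum_card_enriched_inv:
  assumes l: "odd l"
  shows "(\<Sum>\<sigma> | \<sigma> permutes {1..n}. card (enriched n l \<sigma>) * card (enriched n k (inv \<sigma>)))
    = card (enriched n (k * l) id)"
proof -
  let ?W = "\<lambda>k. {1..n} \<rightarrow>\<^sub>E {..<k::nat}"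
  have l0: "l > 0" using l by (cases l) auto
  let ?D = "SIGMA w:?W l. enriched n k (inv (std n w))"
  let ?f = "\<lambda>(w, f). \<lambda>i\<in>{1..n}. snake l (f i) (w i)"
  let ?g = "\<lambda>h. (\<lambda>i\<in>{1..n}. if even (h i div l) then h i mod l else l - 1 - h i mod l, \<lambda>i\<in>{1..n}. h i div l)"
  have iff: "(\<lambda>i\<in>{1..n}. snake l (f i) (w i)) \<in> enriched n (k * l) id \<longleftrightarrow> f \<in> enriched n k (inv (std n w))"
    if w: "w \<in> ?W l" and f: "f \<in> extensional {1..n}" for w f
  proof -
    have wl: "w i < l" if "i \<in> {1..n}" for i using w that by auto
    have "snake l (f i) (w i) < k * l \<longleftrightarrow> f i < k" if "i \<in> {1..n}" for i
      using snake[OF wl[OF that], of "f i"] l0 by (metis div_less_iff_less_mult)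
    then have 1: "(\<lambda>i\<in>{1..n}. snake l (f i) (w i)) \<in> ?W (k * l) \<longleftrightarrow> f \<in> ?W k"
      using f by (auto simp: PiE_def Pi_def)
    have 2: "(snake l (f i) (w i) < snake l (f (Suc i)) (w (Suc i)) \<or>
        snake l (f i) (w i) = snake l (f (Suc i)) (w (Suc i)) \<and> even (snake l (f i) (w i))) \<longleftrightarrow>
        (f i < f (Suc i) \<or> f i = f (Suc i) \<and> (even (f i) \<longleftrightarrow> inv (std n w) i < inv (std n w) (Suc i)))"
      if "i \<in> {1..<n}" for i
      unfolding inv_std_less_iff[OF that] by (rule snake_order[OF l]) (use wl that in auto)
    show ?thesis unfolding enriched_def mem_Collect_eq
    proof (intro conj_cong 1 ball_cong refl)
      fix i assume i: "i \<in> {1..<n}"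
      then have "i \<in> {1..n}" "Suc i \<in> {1..n}" by auto
      then show "((\<lambda>i\<in>{1..n}. snake l (f i) (w i)) i < (\<lambda>i\<in>{1..n}. snake l (f i) (w i)) (Suc i) \<or>
          (\<lambda>i\<in>{1..n}. snake l (f i) (w i)) i = (\<lambda>i\<in>{1..n}. snake l (f i) (w i)) (Suc i) \<and>
          (even ((\<lambda>i\<in>{1..n}. snake l (f i) (w i)) i) \<longleftrightarrow> id i < id (Suc i))) \<longleftrightarrow>
        (f i < f (Suc i) \<or> f i = f (Suc i) \<and> (even (f i) \<longleftrightarrow> inv (std n w) i < inv (std n w) (Suc i)))"
        using 2[OF i] by simp
    qed
  qed
  have "bij_betw ?f ?D (enriched n (k * l) id)"
  proof (rule bij_betw_byWitness[where f' = ?g])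
    show "\<forall>x\<in>?D. ?g (?f x) = x"
    proof
      fix x assume "x \<in> ?D"
      then obtain w f where x: "x = (w, f)" and w: "w \<in> ?W l" and f: "f \<in> enriched n k (inv (std n w))"
        by blast
      have "f \<in> extensional {1..n}" "w \<in> extensional {1..n}" using f w by (auto simp: enriched_def PiE_def)
      moreover have wl: "w i < l" if "i \<in> {1..n}" for i using w that by auto
      \<comment> \<open>Reversing a column index twice restores it, which is what odd rows
        require.\<close>
      moreover have "l - Suc (l - Suc (w i)) = w i" if "i \<in> {1..n}" for i using wl[OF that] by simp
      ultimately show "?g (?f x) = x" unfolding x
        by (auto simp: fun_eq_iff snake extensional_def)
    qed
    have ext: "?f (?g h) = h" if "h \<in> extensional {1..n}" for h
      using that snake_inverse[OF l0] by (auto simp: fun_eq_iff extensional_def)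
    show "\<forall>h\<in>enriched n (k * l) id. ?f (?g h) = h"
      using ext by (auto simp: enriched_def PiE_def)
    show "?f ` ?D \<subseteq> enriched n (k * l) id"
    proof (rule image_subsetI)
      fix x assume "x \<in> ?D"
      then obtain w f where x: "x = (w, f)" and w: "w \<in> ?W l" and f: "f \<in> enriched n k (inv (std n w))"
        by blast
      then have "f \<in> extensional {1..n}" by (auto simp: enriched_def PiE_def)
      then show "?f x \<in> enriched n (k * l) id" using iff[OF w] f x by simp
    qed
    show "?g ` enriched n (k * l) id \<subseteq> ?D"
    proof (rule image_subsetI)
      fix h assume h: "h \<in> enriched n (k * l) id"
      have "(\<lambda>i\<in>{1..n}. if even (h i div l) then h i mod l else l - 1 - h i mod l) \<in> ?W l"
        using l0 by auto
      moreover have "?f (?g h) \<in> enriched n (k * l) id"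
        using h ext[of h] by (simp add: enriched_def PiE_def)
      ultimately show "?g h \<in> ?D" using iff[of "fst (?g h)" "snd (?g h)"] by (simp only: mem_Sigma_iff fst_conv snd_conv prod.case restrict_extensional simp_thms)
    qed
  qed
  then have "card (enriched n (k * l) id) = card ?D" by (simp add: bij_betw_same_card)
  also have "\<dots> = (\<Sum>w\<in>?W l. card (enriched n k (inv (std n w))))"
    by (intro card_SigmaI) (auto intro: finite_PiE finite_enriched)
  also have "\<dots> = (\<Sum>\<sigma> | \<sigma> permutes {1..n}. card (enriched n l \<sigma>) * card (enriched n k (inv \<sigma>)))"
    using sum_enriched_eq_sum_words[of n l "\<lambda>\<sigma>. card (enriched n k (inv \<sigma>))"] by simp
  finally show ?thesis ..
qed

section \<open>Substitution into polynomials\<close>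

text \<open>The linear map that sends the monomial \<open>t ^ lpk n \<sigma>\<close> to the
  generating function of the enriched counts of \<open>\<sigma>\<close>.\<close>

definition peak_subst :: "nat \<Rightarrow> 'a::field_char_0 poly \<Rightarrow> 'a fps" where
  "peak_subst n p = base_gf n * (fps_of_poly p oo peak_gf)"

lemma peak_gf_nth_0: "peak_gf $ 0 = (0 :: 'a::field_char_0)"
  by (simp add: peak_gf_def mult.assoc)

lemma peak_gf_nth_1: "peak_gf $ 1 = (4 :: 'a::field_char_0)"
proof -
  have "peak_gf = fps_X * (fps_const 4 * inverse (1 + fps_X :: 'a fps) ^ 2)"
    by (simp add: peak_gf_def numeral_fps_const ac_simps)
  then have "peak_gf $ 1 = (fps_X * (fps_const 4 * inverse (1 + fps_X :: 'a fps) ^ 2)) $ 1"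
    by (rule arg_cong)
  then show ?thesis by (simp add: fps_power_zeroth)
qed

text \<open>The factor \<open>base_gf n\<close> has constant term 1 and cancels. Composition with
  \<open>peak_gf\<close> is injective because its constant term is 0 and its linear coefficient 4 is
  nonzero in characteristic zero.\<close>

lemma peak_subst_inj: "peak_subst n p = peak_subst n q \<Longrightarrow> p = q"
proof -
  assume eq: "peak_subst n p = peak_subst n q"
  have "base_gf n $ 0 = (1 :: 'a)" by (simp add: base_gf_def fps_power_zeroth)
  then have "base_gf n \<noteq> (0 :: 'a fps)" by auto
  with eq have "fps_of_poly p oo peak_gf = fps_of_poly q oo peak_gf"
    by (simp add: peak_subst_def)
  then show "p = q"
    using fps_compose_inj_right[of "peak_gf :: 'a fps"] by (simp add: peak_gf_nth_0 peak_gf_nth_1 fps_of_poly_eq_iff del: One_nat_def)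
qed

lemma peak_subst_sum_smult:
  "peak_subst n (\<Sum>i\<in>A. smult (c i) (p i)) $ a = (\<Sum>i\<in>A. c i * peak_subst n (p i) $ a)"
proof -
  have "(fps_const c * f) oo peak_gf = fps_const c * (f oo peak_gf)" for c :: 'a and f
    using fps_compose_mult_distrib[OF peak_gf_nth_0, of "fps_const c" f] by simp
  then have "peak_subst n (\<Sum>i\<in>A. smult (c i) (p i)) = (\<Sum>i\<in>A. fps_const (c i) * peak_subst n (p i))"
    by (simp add: peak_subst_def fps_of_poly_sum fps_compose_sum_distrib fps_of_poly_smult
        sum_distrib_left mult.left_commute)
  then show ?thesis by (simp add: fps_sum_nth)
qed

lemma peak_subst_monom_lpk:
  assumes "\<sigma> permutes {1..n}"
  shows "peak_subst n (monom 1 (lpk n \<sigma>)) $ a = (of_nat (card (enriched n (2 * a + 1) \<sigma>)) :: 'a::field_char_0)"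
proof -
  have "peak_subst n (monom 1 (lpk n \<sigma>)) = base_gf n * (peak_gf :: 'a fps) ^ lpk n \<sigma>"
    by (simp add: peak_subst_def fps_of_poly_monom' fps_compose_power[OF peak_gf_nth_0, symmetric]
        peak_gf_nth_0)
  then show ?thesis by (simp add: enriched_gf[OF assms, symmetric])
qed

text \<open>The formal polynomial behind \<open>P_lpk\<close>. The trivial \<open>smult 1\<close>
  gives the sum the shape of \<open>peak_subst_sum_smult\<close>.\<close>

definition lpk_poly :: "nat \<Rightarrow> 'a::field_char_0 poly" where
  "lpk_poly k = (\<Sum>\<sigma> | \<sigma> permutes {1..k}. smult 1 (monom 1 (lpk k \<sigma>)))"

lemma poly_lpk_poly: "poly (lpk_poly k) t = P_lpk k t"
  by (simp add: lpk_poly_def P_lpk_def poly_sum poly_monom)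

text \<open>By linearity the coefficient is the total of the enriched counts over all permutations,
  hence the number of words of length \<open>k\<close> in \<open>2 * a + 1\<close> letters.\<close>

lemma peak_subst_lpk_poly: "peak_subst k (lpk_poly k) $ a = (of_nat (2 * a + 1) ^ k :: 'a::field_char_0)"
proof -
  have "peak_subst k (lpk_poly k) $ a = (\<Sum>\<sigma> | \<sigma> permutes {1..k}. (of_nat (card (enriched k (2 * a + 1) \<sigma>)) :: 'a))"
    unfolding lpk_poly_def peak_subst_sum_smult by (intro sum.cong refl) (simp add: peak_subst_monom_lpk)
  also have "\<dots> = of_nat ((2 * a + 1) ^ k)"
    unfolding of_nat_sum[symmetric] sum_card_enriched ..
  finally show ?thesis by simp
qed

text \<open>Since \<open>1 - 4 * x / (1 + x)^2 = ((1 - x) / (1 + x))^2\<close>, each factor undoes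
  two steps of \<open>base_gf\<close>.\<close>

lemma base_gf_mult_one_minus_peak_gf:
  "base_gf (k + 2 * d) * (1 - peak_gf) ^ d = (base_gf k :: 'a::field_char_0 fps)"
proof (induction d)
  case (Suc d)
  let ?A = "1 - fps_X :: 'a fps" and ?B = "1 + fps_X :: 'a fps"
  let ?u = "inverse ?A" and ?v = "inverse ?B"
  have "1 - peak_gf = (?B * ?v) ^ 2 - peak_gf" by (simp add: one_plus_fps_X_inverse)
  also have "\<dots> = ?A ^ 2 * ?v ^ 2"
    by (simp add: peak_gf_def power_mult_distrib power2_eq_square algebra_simps)
  finally have S: "1 - peak_gf = ?A ^ 2 * ?v ^ 2" .
  have "base_gf (k + 2 * Suc d) * (1 - peak_gf) ^ Suc d
    = (?B * ?u) * (?B * ?u) * (1 - peak_gf) * (base_gf (k + 2 * d) * (1 - peak_gf) ^ d)"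
    by (simp add: base_gf_Suc ac_simps)
  also have "(?B * ?u) * (?B * ?u) * (1 - peak_gf) = (?A * ?u) ^ 2 * (?B * ?v) ^ 2"
    unfolding S by (simp only: power2_eq_square ac_simps)
  finally show ?case by (simp add: Suc.IH one_plus_fps_X_inverse one_minus_fps_X_inverse)
qed simp

text \<open>This is the origin of the powers of \<open>1 - s\<close> and \<open>1 - t\<close> in the
  theorem: they lower the index of the transform from \<open>n\<close> to \<open>k\<close>.\<close>

lemma peak_subst_shift:
  "peak_subst (k + 2 * d) ([:1, -1:] ^ d * p) = peak_subst k (p :: 'a::field_char_0 poly)"
proof -
  have "[:1, -1 :: 'a:] = 1 - [:0, 1:]" by (simp add: one_pCons)
  then have "fps_of_poly [:1, -1 :: 'a:] oo peak_gf = 1 - peak_gf"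
    by (simp only: fps_of_poly_diff fps_of_poly_1 fps_of_poly_fps_X fps_compose_sub_distrib
        fps_compose_1 fps_X_fps_compose_startby0[OF peak_gf_nth_0])
  then have "fps_of_poly ([:1, -1:] ^ d * p) oo peak_gf = (1 - peak_gf) ^ d * (fps_of_poly p oo peak_gf)"
    by (simp add: fps_of_poly_mult fps_of_poly_power fps_compose_mult_distrib peak_gf_nth_0
        fps_compose_power[symmetric])
  then show ?thesis
    using base_gf_mult_one_minus_peak_gf[of k d, where 'a = 'a] by (simp add: peak_subst_def mult.assoc[symmetric])
qed

section \<open>Comparison of coefficients and the final identity\<close>

lemma sum_e_power:
  "(\<Sum>k = 0..n. of_nat (e n k) * y ^ k) = odd_cycle_poly {1..n} (y :: 'a::comm_semiring_1)"
proof -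
  let ?c = "\<lambda>p. card (odd_cycles n p)" and ?P = "{p. p permutes {1..n}}"
  have "?c p \<le> n" for p
  proof -
    have "?c p \<le> card (orbit p ` {1..n})" unfolding odd_cycles_def by (intro card_mono) auto
    also have "\<dots> \<le> card {1..n}" by (intro card_image_le) auto
    finally show ?thesis by simp
  qed
  then have "(\<Sum>k = 0..n. \<Sum>p\<in>{p \<in> ?P. ?c p = k}. y ^ ?c p) = (\<Sum>p\<in>?P. y ^ ?c p)"
    by (intro sum.group) (auto intro: finite_permutations)
  moreover have "(\<Sum>p\<in>{p \<in> ?P. ?c p = k}. y ^ ?c p) = of_nat (e n k) * y ^ k" for k
    by (simp add: e_def)
  ultimately show ?thesis
    by (simp add: odd_cycle_poly_def num_odd_def odd_cycles_def)
qed

lemma lpk_id: "lpk n id = 0"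
  by (simp add: lpk_def is_left_peak_def is_peak_def)

text \<open>A product of odd bounds is again an odd bound \<open>2 * m + 1\<close>, so the joint
  count is a coefficient of \<open>base_gf n\<close>. That is the odd cycle polynomial at
  \<open>2 * m + 1\<close> over \<open>n!\<close>, and the powers of \<open>2 * m + 1\<close> split
  into powers of the two bounds.\<close>

lemma sum_enriched_eq_sum_e:
  "(\<Sum>\<sigma> | \<sigma> permutes {1..n}. of_nat (card (enriched n (2 * b + 1) (inv \<sigma>))) * of_nat (card (enriched n (2 * a + 1) \<sigma>)))
    = (\<Sum>k = 0..n. of_nat (e n k) / fact n * of_nat (2 * b + 1) ^ k * (of_nat (2 * a + 1) ^ k :: 'a::field_char_0))"
proof -
  define m where "m = 2 * a * b + a + b"
  have m: "(2 * b + 1) * (2 * a + 1) = 2 * m + 1" by (simp add: m_def algebra_simps)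
  have "(\<Sum>\<sigma> | \<sigma> permutes {1..n}. of_nat (card (enriched n (2 * b + 1) (inv \<sigma>))) * of_nat (card (enriched n (2 * a + 1) \<sigma>)))
    = (of_nat (\<Sum>\<sigma> | \<sigma> permutes {1..n}. card (enriched n (2 * a + 1) \<sigma>) * card (enriched n (2 * b + 1) (inv \<sigma>))) :: 'a)"
    by (simp only: of_nat_sum of_nat_mult mult.commute)
  also have "\<dots> = of_nat (card (enriched n (2 * m + 1) id))"
    by (subst sum_card_enriched_inv) (simp_all only: m, simp)
  also have "\<dots> = base_gf n $ m"
    using peak_subst_monom_lpk[OF permutes_id, of n m, where 'a = 'a] by (simp add: lpk_id peak_subst_def)
  also have "\<dots> = odd_cycle_poly {1..n} (of_nat (2 * m + 1)) / fact n"
    by (subst odd_cycle_poly_odd) simp_all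
  also have "\<dots> = (\<Sum>k = 0..n. of_nat (e n k) * of_nat (2 * m + 1) ^ k) / fact n"
    by (simp only: sum_e_power)
  also have "\<dots> = (\<Sum>k = 0..n. of_nat (e n k) / fact n * of_nat (2 * b + 1) ^ k * of_nat (2 * a + 1) ^ k)"
    unfolding m[symmetric] sum_divide_distrib of_nat_mult power_mult_distrib
    by (intro sum.cong refl) (simp add: field_simps)
  finally show ?thesis .
qed

theorem theorem4p4:
  fixes s t :: "'a::field_char_0" and n :: nat
  assumes "n \<ge> 1"
  shows "P_lpk_ilpk n s t =
    1 / fact n * (\<Sum>k = 0..n. of_nat (e n k) * ((1 - s) * (1 - t)) ^ ((n - k) div 2)
                               * P_lpk k s * P_lpk k t)"
proof -
  let ?P = "{\<sigma>. \<sigma> permutes {1..n}}"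
  \<comment> \<open>The part of the \<open>k\<close>-th summand that depends on one variable, as a
    formal polynomial.\<close>
  define U :: "nat \<Rightarrow> 'a poly" where "U k = [:1, -1:] ^ ((n - k) div 2) * lpk_poly k" for k
  have poly_U: "poly (U k) x = (1 - x) ^ ((n - k) div 2) * P_lpk k x" for k x
    by (simp add: U_def poly_lpk_poly)
  \<comment> \<open>The transform of \<open>U k\<close> is computed only for even
    \<open>n - k\<close>; in the odd case the factor \<open>e n k\<close> vanishes, so it is kept in
    the equation. The free \<open>c\<close> serves both rounds below.\<close>
  have U: "of_nat (e n k) / fact n * c * peak_subst n (U k) $ a
      = of_nat (e n k) / fact n * c * of_nat (2 * a + 1) ^ k" if "k \<le> n" for k a c
  proof (cases "even (n - k)")
    case True
    then have n: "k + 2 * ((n - k) div 2) = n" using that by simp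
    have "peak_subst n (U k) = peak_subst k (lpk_poly k)"
      unfolding U_def using peak_subst_shift[of k "(n - k) div 2" "lpk_poly k :: 'a poly"] n by simp
    then show ?thesis by (simp only: peak_subst_lpk_poly)
  next
    case False
    then show ?thesis using e_eq_0_if_odd[OF that] by simp
  qed
  have inv: "inv \<sigma> permutes {1..n}" if "\<sigma> \<in> ?P" for \<sigma> using that permutes_inv by auto
  \<comment> \<open>First round: \<open>b\<close> is fixed and the variable belonging to
    \<open>lpk n \<sigma>\<close> is recovered as a polynomial, then evaluated at
    \<open>s\<close>.\<close>
  have in_s: "(\<Sum>\<sigma>\<in>?P. of_nat (card (enriched n (2 * b + 1) (inv \<sigma>))) * s ^ lpk n \<sigma>)
    = (\<Sum>k = 0..n. of_nat (e n k) / fact n * of_nat (2 * b + 1) ^ k * poly (U k) s)" for b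
  proof -
    let ?L = "\<Sum>\<sigma>\<in>?P. smult (of_nat (card (enriched n (2 * b + 1) (inv \<sigma>)))) (monom 1 (lpk n \<sigma>)) :: 'a poly"
    let ?R = "\<Sum>k = 0..n. smult (of_nat (e n k) / fact n * of_nat (2 * b + 1) ^ k) (U k)"
    have "peak_subst n ?L = peak_subst n ?R"
    proof (rule fps_ext)
      fix a
      have "peak_subst n ?L $ a = (\<Sum>\<sigma>\<in>?P. of_nat (card (enriched n (2 * b + 1) (inv \<sigma>)))
          * of_nat (card (enriched n (2 * a + 1) \<sigma>)))"
        unfolding peak_subst_sum_smult by (intro sum.cong refl) (simp add: peak_subst_monom_lpk)
      also have "\<dots> = peak_subst n ?R $ a"
        unfolding peak_subst_sum_smult sum_enriched_eq_sum_e
        by (intro sum.cong refl U[symmetric]) auto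
      finally show "peak_subst n ?L $ a = peak_subst n ?R $ a" .
    qed
    from peak_subst_inj[OF this] have "poly ?L s = poly ?R s" by (rule arg_cong)
    then show ?thesis by (simp add: poly_sum poly_monom)
  qed
  \<comment> \<open>Second round: \<open>s\<close> is now a scalar, the polynomials are in the other
    variable, and \<open>in_s\<close> supplies their transforms coefficient by coefficient in
    \<open>b\<close>.\<close>
  let ?L = "\<Sum>\<sigma>\<in>?P. smult (s ^ lpk n \<sigma>) (monom 1 (lpk n (inv \<sigma>)))"
  let ?R = "\<Sum>k = 0..n. smult (of_nat (e n k) / fact n * poly (U k) s) (U k)"
  have "peak_subst n ?L = peak_subst n ?R"
  proof (rule fps_ext)
    fix b
    have "peak_subst n ?L $ b = (\<Sum>\<sigma>\<in>?P. of_nat (card (enriched n (2 * b + 1) (inv \<sigma>))) * s ^ lpk n \<sigma>)"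
      unfolding peak_subst_sum_smult
      by (intro sum.cong refl) (simp only: peak_subst_monom_lpk[OF inv] mult.commute)
    also have "\<dots> = (\<Sum>k = 0..n. of_nat (e n k) / fact n * poly (U k) s * of_nat (2 * b + 1) ^ k)"
      unfolding in_s by (intro sum.cong refl) (simp only: ac_simps)
    also have "\<dots> = peak_subst n ?R $ b"
      unfolding peak_subst_sum_smult by (intro sum.cong refl U[symmetric]) auto
    finally show "peak_subst n ?L $ b = peak_subst n ?R $ b" .
  qed
  from peak_subst_inj[OF this] have "poly ?L t = poly ?R t" by (rule arg_cong)
  moreover have "poly ?L t = P_lpk_ilpk n s t"
    by (simp add: P_lpk_ilpk_def ilpk_def poly_sum poly_monom)
  moreover have "poly ?R t = 1 / fact n * (\<Sum>k = 0..n. of_nat (e n k) * ((1 - s) * (1 - t)) ^ ((n - k) div 2)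
                               * P_lpk k s * P_lpk k t)"
    unfolding poly_sum sum_distrib_left
    by (intro sum.cong refl) (simp add: poly_U power_mult_distrib)
  ultimately show ?thesis by simp
qed

end
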